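(* Let $\alpha\in(0,2)$, let $a$ be a continuous positive function on $\mathbb{R}$ and let $b$ be a differentiable function on $\mathbb{R}$. Let $\mathscr{P}$ be the set of measures on $\mathbb{R}$ that are absolutely continuous with respect to Lebesgue measure. Then the Lévy-type operator $$\mathcal{L}=a(x)\Delta^{\alpha/2}+b(x)\frac{\mathrm{d}}{\mathrm{d}x}$$ is symmetric with respect to a measure $\mu\in\mathscr{P}$ if and only if $b\equiv 0$. In this case, its reversible measure is $\mu(\mathrm{d}x):=a(x)^{-1}\mathrm{d}x=\sigma(x)^{-\alpha}\mathrm{d}x$, where $\sigma(x):=a(x)^{1/\alpha}$.
   Context: $\Delta^{\alpha/2}:=-(-\Delta)^{\alpha/2}$ is the fractional Laplacian on $\mathbb{R}$, given by $$\Delta^{\alpha/2}f(x)=\int_{\mathbb{R}\setminus\{0\}}\left(f(x+z)-f(x)-\nabla f(x)\cdot z\,\mathbf{1}_{\{|z|\leqslant 1\}}\right)\frac{C_\alpha}{|z|^{1+\alpha}}\,\mathrm{d}z,\qquad C_\alpha:=\frac{\alpha 2^{\alpha-1}\Gamma((\alpha+1)/2)}{\pi^{1/2}\Gamma(1-\alpha/2)},$$ or equivalently by the principal value integral $\Delta^{\alpha/2}f(x)=\lim_{j\to\infty}\int_{\{|y-x|>1/j\}}(f(y)-f(x))\frac{C_\alpha}{|y-x|^{1+\alpha}}\,\mathrm{d}y$. For a measure $\mu$ on $\mathbb{R}$, $L^2(\mu)$ is the space of square integrable functions with scalar product $\langle f,g\rangle_\mu:=\int_{\mathbb{R}}f(x)g(x)\,\mu(\mathrm{d}x)$.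 The operator $\mathcal{L}$ is called symmetric (with respect to $\mu$) if there exists a measure $\mu$ on $\mathbb{R}$ such that $\langle\mathcal{L}f,g\rangle_\mu=\langle f,\mathcal{L}g\rangle_\mu$ for all $f,g\in L^2(\mu)$; a measure $\mu$ satisfying this is called the reversible measure of $\mathcal{L}$.
   Formalization: Symmetry is required for f, g smooth with compact support (not all of L²(μ), where Lf is undefined); μ must be nonzero with these functions in L²(μ) and the pairings convergent; the reversible measure is unique up to a positive constant. *)

theory Defs
  imports "HOL-Analysis.Analysis"
begin

definition frac_const :: "real \<Rightarrow> real" where
  "frac_const \<alpha> =
     \<alpha> * 2 powr (\<alpha> - 1) * Gamma ((\<alpha> + 1) / 2) / (sqrt pi * Gamma (1 - \<alpha> / 2))"

definition frac_laplacian :: "real \<Rightarrow> (real \<Rightarrow> real) \<Rightarrow> real \<Rightarrow> real" where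
  "frac_laplacian \<alpha> f x =
     (LINT z:(UNIV - {0})|lborel.
        (f (x + z) - f x - deriv f x * z * indicator {z. \<bar>z\<bar> \<le> 1} z)
          * (frac_const \<alpha> / \<bar>z\<bar> powr (1 + \<alpha>)))"

definition levy_operator ::
    "real \<Rightarrow> (real \<Rightarrow> real) \<Rightarrow> (real \<Rightarrow> real) \<Rightarrow> (real \<Rightarrow> real) \<Rightarrow> real \<Rightarrow> real" where
  "levy_operator \<alpha> a b f x = a x * frac_laplacian \<alpha> f x + b x * deriv f x"

definition test_functions :: "(real \<Rightarrow> real) set" where
  "test_functions =
     {f. (\<forall>n x. (deriv ^^ n) f differentiable (at x)) \<and> compact (closure {x. f x \<noteq> 0})}"

definition L2_functions :: "real measure \<Rightarrow> (real \<Rightarrow> real) set" where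
  "L2_functions \<mu> = {f \<in> borel_measurable \<mu>. integrable \<mu> (\<lambda>x. (f x)\<^sup>2)}"

definition L2_inner :: "real measure \<Rightarrow> (real \<Rightarrow> real) \<Rightarrow> (real \<Rightarrow> real) \<Rightarrow> real" where
  "L2_inner \<mu> f g = (LINT x|\<mu>. f x * g x)"

definition ac_measures :: "real measure set" where
  "ac_measures = {\<mu>. sets \<mu> = sets borel \<and> absolutely_continuous lborel \<mu>}"

(* L is an unbounded operator, so symmetry is tested on a domain: the smooth compactly
   supported functions, which must lie in L2(mu) (equivalently, mu is locally finite).
   L f itself need not lie in L2(mu), so the pairing of L f with g is required to converge,
   which also excludes the default value 0 of divergent integrals. The zero measure, for
   which every operator would be symmetric, is excluded. *)
definition reversible_measure ::
    "((real \<Rightarrow> real) \<Rightarrow> real \<Rightarrow> real) \<Rightarrow> real measure \<Rightarrow> bool" where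
  "reversible_measure L \<mu> \<longleftrightarrow>
     sets \<mu> = sets borel \<and> emeasure \<mu> UNIV \<noteq> 0 \<and> test_functions \<subseteq> L2_functions \<mu> \<and>
     (\<forall>f \<in> test_functions. \<forall>g \<in> test_functions.
        integrable \<mu> (\<lambda>x. L f x * g x) \<and> integrable \<mu> (\<lambda>x. f x * L g x) \<and>
        L2_inner \<mu> (L f) g = L2_inner \<mu> f (L g))"

definition symmetric_operator_in ::
    "real measure set \<Rightarrow> ((real \<Rightarrow> real) \<Rightarrow> real \<Rightarrow> real) \<Rightarrow> bool" where
  "symmetric_operator_in \<P> L \<longleftrightarrow> (\<exists>\<mu> \<in> \<P>. reversible_measure L \<mu>)"

end

theory Submission
  imports Defs
begin

text \<open>
  On test functions the fractional Laplacian is symmetric with respect to Lebesgue measure, which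
  gives the reversible measure \<open>dx / a\<close> when \<open>b = 0\<close>. Conversely, let \<open>p dx\<close> be reversible and
  \<open>W = p a\<close>. For nonnegative test functions \<open>f\<close>, \<open>g\<close> with disjoint supports the local drift term
  disappears, and symmetry says that the integral of \<open>(W x - W y) g x f y / |y - x|^(1 + \<alpha>)\<close>
  vanishes. Hence \<open>W\<close> is almost everywhere equal to a constant \<open>c\<close> and \<open>p = c / a\<close>. The jump part
  is then symmetric on its own, so the drift part is symmetric too: \<open>b / a (f' g - f g')\<close> has
  integral zero. The choice \<open>f x = x g x\<close> turns the integrand into \<open>b / a g\<^sup>2\<close>, and letting \<open>g\<close>
  concentrate at a point gives \<open>b = 0\<close>.
\<close>

section \<open>Smooth functions\<close>

text \<open>A graded form of smoothness. Closure under products and affine substitution is proved by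
  induction on the order \<open>n\<close>, for which \<open>smooth\<close> has no parameter. Only
  derivatives of order below \<open>n\<close> are constrained, so order 0 imposes nothing and starts
  every induction.\<close>

definition times_differentiable :: "nat \<Rightarrow> (real \<Rightarrow> real) \<Rightarrow> bool" where
  "times_differentiable n f \<longleftrightarrow> (\<forall>k<n. \<forall>x. (deriv ^^ k) f differentiable (at x))"

definition smooth :: "(real \<Rightarrow> real) \<Rightarrow> bool" where
  "smooth f \<longleftrightarrow> (\<forall>n x. (deriv ^^ n) f differentiable (at x))"

lemma smooth_iff_times_differentiable: "smooth f \<longleftrightarrow> (\<forall>n. times_differentiable n f)"
  unfolding smooth_def times_differentiable_def by blast

lemma times_differentiable_0 [simp]: "times_differentiable 0 f"
  by (simp add: times_differentiable_def)

lemma times_differentiable_Suc: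
  "times_differentiable (Suc n) f \<longleftrightarrow>
     (\<forall>x. f differentiable (at x)) \<and> times_differentiable n (deriv f)"
  unfolding times_differentiable_def
  by (auto simp: less_Suc_eq_0_disj funpow_swap1 simp del: funpow.simps)
     (auto simp: funpow_swap1)

lemma times_differentiable_SucD: "times_differentiable (Suc n) f \<Longrightarrow> times_differentiable n f"
  by (simp add: times_differentiable_def)

lemma times_differentiable_SucI:
  assumes "\<And>x. (f has_real_derivative f' x) (at x)" and "times_differentiable n f'"
  shows "times_differentiable (Suc n) f"
proof -
  have "deriv f = f'"
    using assms(1) by (intro ext DERIV_imp_deriv)
  with assms show ?thesis
    by (auto simp: times_differentiable_Suc real_differentiable_def)
qed

lemma times_differentiable_DERIV:
  "times_differentiable (Suc n) f \<Longrightarrow> (f has_real_derivative deriv f x) (at x)"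
  by (simp add: times_differentiable_Suc DERIV_deriv_iff_real_differentiable)

lemma times_differentiable_const: "times_differentiable n (\<lambda>x. c)"
proof (induction n arbitrary: c)
  case (Suc n)
  show ?case by (rule times_differentiable_SucI[OF _ Suc]) (rule DERIV_const)
qed simp

lemma times_differentiable_add:
  "times_differentiable n f \<Longrightarrow> times_differentiable n g \<Longrightarrow> times_differentiable n (\<lambda>x. f x + g x)"
proof (induction n arbitrary: f g)
  case (Suc n)
  show ?case
    by (rule times_differentiable_SucI[OF DERIV_add])
       (use Suc in \<open>auto intro: times_differentiable_DERIV simp: times_differentiable_Suc\<close>)
qed simp

lemma times_differentiable_mult:
  "times_differentiable n f \<Longrightarrow> times_differentiable n g \<Longrightarrow> times_differentiable n (\<lambda>x. f x * g x)"
proof (induction n arbitrary: f g)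
  case (Suc n)
  note D = times_differentiable_DERIV[OF Suc.prems(1)] times_differentiable_DERIV[OF Suc.prems(2)]
  show ?case
  proof (rule times_differentiable_SucI[OF DERIV_mult[OF D]])
    show "times_differentiable n (\<lambda>x. deriv f x * g x + deriv g x * f x)"
      using Suc by (intro times_differentiable_add Suc.IH)
        (auto simp: times_differentiable_Suc intro: times_differentiable_SucD)
  qed
qed simp

lemma times_differentiable_affine:
  "times_differentiable n f \<Longrightarrow> times_differentiable n (\<lambda>x. f (c * x + d))"
proof (induction n arbitrary: f)
  case (Suc n)
  have "((\<lambda>x. f (c * x + d)) has_real_derivative deriv f (c * x + d) * c) (at x)" for x
    by (rule DERIV_chain2[OF times_differentiable_DERIV[OF Suc.prems]])
       (auto intro!: derivative_eq_intros)
  then show ?case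
    using Suc by (intro times_differentiable_SucI[where f' = "\<lambda>x. deriv f (c * x + d) * c"])
      (auto intro!: times_differentiable_mult times_differentiable_const simp: times_differentiable_Suc)
qed simp

lemma smooth_mult: "smooth f \<Longrightarrow> smooth g \<Longrightarrow> smooth (\<lambda>x. f x * g x)"
  and smooth_affine: "smooth f \<Longrightarrow> smooth (\<lambda>x. f (c * x + d))"
  by (simp_all add: smooth_iff_times_differentiable times_differentiable_mult
      times_differentiable_affine)

lemma smooth_ident: "smooth (\<lambda>x. x)"
proof -
  have "times_differentiable n (\<lambda>x. x)" for n
    by (cases n) (auto intro!: times_differentiable_SucI[where f' = "\<lambda>_. 1"]
        times_differentiable_const derivative_eq_intros)
  then show ?thesis by (simp add: smooth_iff_times_differentiable)
qed

lemma smooth_const: "smooth (\<lambda>x. c)"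
  by (simp add: smooth_iff_times_differentiable times_differentiable_const)

lemma smooth_DERIV: "smooth f \<Longrightarrow> (f has_real_derivative deriv f x) (at x)"
  using times_differentiable_DERIV smooth_iff_times_differentiable by blast

lemma smooth_deriv: "smooth f \<Longrightarrow> smooth (deriv f)"
  using times_differentiable_Suc smooth_iff_times_differentiable by blast

lemma smooth_continuous_on: "smooth f \<Longrightarrow> continuous_on S f"
  by (meson DERIV_isCont continuous_at_imp_continuous_on smooth_DERIV)

lemma smooth_borel_measurable: "smooth f \<Longrightarrow> f \<in> borel_measurable borel"
  by (intro borel_measurable_continuous_onI smooth_continuous_on)

text \<open>The family \<open>p \<mapsto> poly p (1/x) * exp (-1/x)\<close> is closed under differentiation,
  which makes every member smooth.\<close>

definition flat_poly :: "real poly \<Rightarrow> real \<Rightarrow> real" where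
  "flat_poly p x = (if 0 < x then poly p (1 / x) * exp (- (1 / x)) else 0)"

text \<open>The factor \<open>t ^ k\<close> is carried along for the induction: splitting off the
  constant coefficient of the polynomial leaves a factor \<open>t\<close>, which raises
  \<open>k\<close> by one.\<close>

lemma poly_times_exp_minus_tendsto_0:
  fixes p :: "real poly"
  shows "((\<lambda>t. t ^ k * poly p t / exp t) \<longlongrightarrow> 0) at_top"
proof (induction p arbitrary: k)
  case (pCons c p)
  have "((\<lambda>t. c * (t ^ k / exp t) + t ^ Suc k * poly p t / exp t) \<longlongrightarrow> c * 0 + 0) at_top"
    by (intro tendsto_intros pCons tendsto_power_div_exp_0)
  then show ?case by (simp add: field_simps)
qed simp

lemma flat_poly_tendsto_0: "((flat_poly p) \<longlongrightarrow> 0) (at 0)"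
proof (rule filterlim_split_at)
  show "(flat_poly p \<longlongrightarrow> 0) (at_left 0)"
    by (rule tendsto_eventually) (auto simp: eventually_at_filter flat_poly_def)
  \<comment> \<open>Substituting \<open>t = 1 / x\<close> turns the limit at 0 from the right into
    the limit at infinity with \<open>k = 0\<close>.\<close>
  have "((\<lambda>x. poly p (inverse x) / exp (inverse x)) \<longlongrightarrow> 0) (at_right 0)"
    using filterlim_compose[OF poly_times_exp_minus_tendsto_0[of 0 p] filterlim_inverse_at_top_right]
    by simp
  then show "(flat_poly p \<longlongrightarrow> 0) (at_right 0)"
    by (rule Lim_transform_eventually)
       (auto simp: eventually_at_filter flat_poly_def exp_minus field_simps)
qed

text \<open>With \<open>t = 1 / x\<close> one has \<open>dt/dx = - t^2\<close>, so
  \<open>p(t) exp(-t)\<close> has derivative \<open>t^2 (p(t) - p'(t)) exp(-t)\<close>; the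
  polynomial \<open>[:0, 0, 1:]\<close> is the factor \<open>t^2\<close>.\<close>

lemma flat_poly_DERIV:
  "(flat_poly p has_real_derivative flat_poly ([:0, 0, 1:] * (p - pderiv p)) x) (at x)"
proof -
  consider "x < 0" | "x = 0" | "0 < x" by linarith
  then show ?thesis
  proof cases
    case 1
    have "((\<lambda>_. 0) has_real_derivative 0) (at x)" by simp
    then have "(flat_poly p has_real_derivative 0) (at x)"
      by (rule DERIV_cong_ev[OF refl _ refl, THEN iffD1, rotated])
         (use 1 in \<open>auto simp: flat_poly_def intro!: eventually_mono[OF eventually_nhds_in_open[of "{..<0}" x]]\<close>)
    with 1 show ?thesis by (simp add: flat_poly_def)
  next
    case 2
    \<comment> \<open>The difference quotient at 0 divides by \<open>x\<close>, that is, multiplies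
      by \<open>1 / x\<close>. It is therefore itself a member of the family, with \<open>p\<close>
      shifted by one degree.\<close>
    have "(flat_poly (pCons 0 p) \<longlongrightarrow> 0) (at 0)" by (rule flat_poly_tendsto_0)
    then have "((\<lambda>h. (flat_poly p (0 + h) - flat_poly p 0) / h) \<longlongrightarrow> 0) (at 0)"
      by (rule Lim_transform_eventually)
         (auto simp: eventually_at_filter flat_poly_def)
    with 2 show ?thesis by (simp add: DERIV_def flat_poly_def)
  next
    case 3
    have "((\<lambda>x. poly p (1 / x) * exp (- (1 / x))) has_real_derivative
        flat_poly ([:0, 0, 1:] * (p - pderiv p)) x) (at x)"
      using 3 by (auto intro!: derivative_eq_intros DERIV_chain2[OF poly_DERIV]
          simp: flat_poly_def field_simps power2_eq_square)
    then show ?thesis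
      by (rule DERIV_cong_ev[OF refl _ refl, THEN iffD1, rotated])
         (use 3 eventually_nhds_in_open[of "{0<..}" x] in
           \<open>auto simp: flat_poly_def elim!: eventually_mono\<close>)
  qed
qed

lemma smooth_flat_poly: "smooth (flat_poly p)"
proof -
  have "times_differentiable n (flat_poly p)" for n
    by (induction n arbitrary: p) (auto intro!: times_differentiable_SucI flat_poly_DERIV)
  then show ?thesis by (simp add: smooth_iff_times_differentiable)
qed

section \<open>Bump functions increasing to indicators of open intervals\<close>

text \<open>\<open>flat_poly 1\<close> is \<open>exp (- 1 / t)\<close> for positive
  \<open>t\<close>. Rescaling the argument raises the values towards 1 but leaves the set of
  positivity \<open>(l, u)\<close> unchanged, so disjointness of supports survives the passage to
  the limit.\<close>

definition bump :: "nat \<Rightarrow> real \<Rightarrow> real \<Rightarrow> real \<Rightarrow> real" where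
  "bump n l u x = flat_poly 1 (real (Suc n) * (x - l)) * flat_poly 1 (real (Suc n) * (u - x))"

lemma smooth_bump: "smooth (bump n l u)"
proof -
  have "smooth (\<lambda>x. flat_poly 1 (real (Suc n) * x + - (real (Suc n) * l)) *
      flat_poly 1 (- real (Suc n) * x + real (Suc n) * u))"
    by (intro smooth_mult smooth_affine smooth_flat_poly)
  then show ?thesis
    by (rule back_subst[of smooth]) (auto simp: bump_def fun_eq_iff algebra_simps)
qed

lemma bump_nonneg [simp]: "0 \<le> bump n l u x"
  by (simp add: bump_def flat_poly_def)

lemma bump_pos_iff: "0 < bump n l u x \<longleftrightarrow> l < x \<and> x < u"
  by (auto simp: bump_def flat_poly_def zero_less_mult_iff simp del: of_nat_Suc)

lemma bump_eq_0_iff: "bump n l u x = 0 \<longleftrightarrow> \<not> (l < x \<and> x < u)"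
  using bump_pos_iff[of n l u x] bump_nonneg[of n l u x] by linarith

lemma flat_poly_scale_mono:
  "m \<le> n \<Longrightarrow> flat_poly 1 (real (Suc m) * t) \<le> flat_poly 1 (real (Suc n) * t)"
  by (auto simp: flat_poly_def zero_less_mult_iff divide_simps simp del: of_nat_Suc)

lemma bump_mono: "m \<le> n \<Longrightarrow> bump m l u x \<le> bump n l u x"
  unfolding bump_def by (intro mult_mono flat_poly_scale_mono) (auto simp: flat_poly_def)

lemma flat_poly_scale_tendsto:
  "(\<lambda>n. flat_poly 1 (real (Suc n) * t)) \<longlonglongrightarrow> indicator {0<..} t"
proof (cases "0 < t")
  case True
  have "(\<lambda>n. exp (- (inverse (real (Suc n)) * (1 / t)))) \<longlonglongrightarrow> exp (- (0 * (1 / t)))"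
    by (intro tendsto_intros LIMSEQ_inverse_real_of_nat)
  with True show ?thesis
    by (simp add: flat_poly_def zero_less_mult_iff field_simps del: of_nat_Suc)
qed (simp add: flat_poly_def zero_less_mult_iff del: of_nat_Suc)

lemma bump_tendsto: "(\<lambda>n. bump n l u x) \<longlonglongrightarrow> indicator {l<..<u} x"
proof -
  have "(\<lambda>n. bump n l u x) \<longlonglongrightarrow> indicator {0<..} (x - l) * indicator {0<..} (u - x)"
    unfolding bump_def by (intro tendsto_mult flat_poly_scale_tendsto)
  then show ?thesis by (auto simp: indicator_def split: if_splits)
qed

section \<open>Test functions and the jump kernel\<close>

lemma test_functions_iff:
  "f \<in> test_functions \<longleftrightarrow> smooth f \<and> (\<exists>R. \<forall>x. f x \<noteq> 0 \<longrightarrow> \<bar>x\<bar> \<le> R)"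
proof -
  have "compact (closure {x. f x \<noteq> 0}) \<longleftrightarrow> bounded {x. f x \<noteq> 0}"
    by (simp add: compact_closure)
  also have "\<dots> \<longleftrightarrow> (\<exists>R. \<forall>x. f x \<noteq> 0 \<longrightarrow> \<bar>x\<bar> \<le> R)"
    by (auto simp: bounded_iff)
  finally show ?thesis by (simp add: test_functions_def smooth_def)
qed

lemma test_functionsI:
  "smooth f \<Longrightarrow> (\<And>x. f x \<noteq> 0 \<Longrightarrow> \<bar>x\<bar> \<le> R) \<Longrightarrow> f \<in> test_functions"
  by (auto simp: test_functions_iff)

lemma test_functions_smooth: "f \<in> test_functions \<Longrightarrow> smooth f"
  by (simp add: test_functions_iff)

lemma test_functions_mult:
  "f \<in> test_functions \<Longrightarrow> smooth g \<Longrightarrow> (\<lambda>x. g x * f x) \<in> test_functions"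
  by (auto simp: test_functions_iff intro: smooth_mult)

lemma bump_test_function: "bump n l u \<in> test_functions"
  by (rule test_functionsI[OF smooth_bump, where R = "\<bar>l\<bar> + \<bar>u\<bar>"]) (auto simp: bump_eq_0_iff)

text \<open>Each point outside \<open>[- R, R]\<close> has a neighbourhood on which the function is
  zero, so the derivative inherits the same radius.\<close>

lemma test_functions_deriv:
  assumes "f \<in> test_functions" shows "deriv f \<in> test_functions"
proof -
  obtain R where R: "\<And>x. f x \<noteq> 0 \<Longrightarrow> \<bar>x\<bar> \<le> R"
    using assms by (auto simp: test_functions_iff)
  show ?thesis
  proof (rule test_functionsI[OF smooth_deriv[OF test_functions_smooth[OF assms]]])
    fix x assume "deriv f x \<noteq> 0"
    show "\<bar>x\<bar> \<le> R"
    proof (rule ccontr)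
      assume "\<not> \<bar>x\<bar> \<le> R"
      moreover have "open {x::real. R < \<bar>x\<bar>}"
        by (intro open_Collect_less continuous_intros)
      ultimately have "\<forall>\<^sub>F y in nhds x. f y = 0"
        using R by (force elim: eventually_mono dest: eventually_nhds_in_open[of _ x])
      then have "(f has_real_derivative 0) (at x)"
        using DERIV_cong_ev[of x x f "\<lambda>_. 0" 0 0] by simp
      with \<open>deriv f x \<noteq> 0\<close> show False by (simp add: DERIV_imp_deriv)
    qed
  qed
qed

lemma continuous_compact_support_integrable:
  fixes f :: "real \<Rightarrow> real"
  assumes "continuous_on UNIV f" and "\<And>x. f x \<noteq> 0 \<Longrightarrow> \<bar>x\<bar> \<le> R"
  shows "integrable lborel f"
proof -
  have "integrable lborel (\<lambda>x. indicator {- R..R} x *\<^sub>R f x)"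
    by (intro borel_integrable_compact) (auto intro: continuous_on_subset assms)
  moreover have "(\<lambda>x. indicator {- R..R} x *\<^sub>R f x) = f"
    using assms(2) by (force simp: indicator_def abs_le_iff fun_eq_iff)
  ultimately show ?thesis by simp
qed

lemma test_functions_mult_integrable:
  assumes "f \<in> test_functions" "continuous_on UNIV g"
  shows "integrable lborel (\<lambda>x. g x * f x)"
proof -
  obtain R where "\<And>x. f x \<noteq> 0 \<Longrightarrow> \<bar>x\<bar> \<le> R"
    using assms by (auto simp: test_functions_iff)
  then show ?thesis
    using smooth_continuous_on[OF test_functions_smooth[OF assms(1)]] assms(2)
    by (intro continuous_compact_support_integrable continuous_on_mult) auto
qed

lemma test_functions_integrable: "f \<in> test_functions \<Longrightarrow> integrable lborel f"
  using test_functions_mult_integrable[of f "\<lambda>_. 1"] by simp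

lemma test_functions_bounded:
  assumes "f \<in> test_functions" obtains M where "\<And>x. \<bar>f x\<bar> \<le> M" "0 \<le> M"
proof -
  obtain R where R: "\<And>x. f x \<noteq> 0 \<Longrightarrow> \<bar>x\<bar> \<le> R"
    using assms by (auto simp: test_functions_iff)
  have "compact (f ` {- R..R})"
    using assms by (intro compact_continuous_image smooth_continuous_on test_functions_smooth) auto
  then obtain M where "\<forall>x\<in>{- R..R}. \<bar>f x\<bar> \<le> M"
    using compact_imp_bounded bounded_iff by (metis imageI real_norm_def)
  then have "\<bar>f x\<bar> \<le> max M 0" for x
    using R[of x] by (cases "f x = 0") (auto simp: abs_le_iff le_max_iff_disj)
  then show ?thesis using that[of "max M 0"] by simp
qed

text \<open>A zero of a nonnegative function is a minimum. This removes both the drift term and the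
  gradient correction at zeros of \<open>f\<close>.\<close>

lemma deriv_eq_0_if_nonneg:
  assumes "f \<in> test_functions" "\<And>x. 0 \<le> f x" "f x = 0" shows "deriv f x = 0"
  by (rule DERIV_local_min[OF smooth_DERIV[OF test_functions_smooth[OF assms(1)]], where d = 1])
     (use assms(2,3) in auto)

section \<open>The jump kernel and the compensated increment\<close>

definition levy_kernel :: "real \<Rightarrow> real \<Rightarrow> real" where
  "levy_kernel \<alpha> z = frac_const \<alpha> / \<bar>z\<bar> powr (1 + \<alpha>)"

text \<open>The first-order Taylor remainder for jumps of size at most 1 and the plain increment for
  larger ones.\<close>

definition levy_remainder :: "(real \<Rightarrow> real) \<Rightarrow> real \<Rightarrow> real \<Rightarrow> real" where
  "levy_remainder f x z = f (x + z) - f x - deriv f x * z * indicator {z. \<bar>z\<bar> \<le> 1} z"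

lemma frac_const_pos: "0 < \<alpha> \<Longrightarrow> \<alpha> < 2 \<Longrightarrow> 0 < frac_const \<alpha>"
  by (simp add: frac_const_def Gamma_real_pos)

lemma levy_kernel_nonneg: "0 < \<alpha> \<Longrightarrow> \<alpha> < 2 \<Longrightarrow> 0 \<le> levy_kernel \<alpha> z"
  using frac_const_pos[of \<alpha>] by (simp add: levy_kernel_def)

lemma levy_kernel_pos: "0 < \<alpha> \<Longrightarrow> \<alpha> < 2 \<Longrightarrow> z \<noteq> 0 \<Longrightarrow> 0 < levy_kernel \<alpha> z"
  using frac_const_pos[of \<alpha>] by (simp add: levy_kernel_def)

lemma levy_kernel_minus [simp]: "levy_kernel \<alpha> (- z) = levy_kernel \<alpha> z"
  by (simp add: levy_kernel_def)

text \<open>Both \<open>0 powr (1 + \<alpha>)\<close> and division by zero evaluate to 0. Integrals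
  against the kernel over the punctured line therefore agree with integrals over the whole
  line.\<close>

lemma levy_kernel_0 [simp]: "levy_kernel \<alpha> 0 = 0"
  by (simp add: levy_kernel_def)

lemma levy_kernel_measurable [measurable]: "levy_kernel \<alpha> \<in> borel_measurable borel"
  unfolding levy_kernel_def[abs_def] by measurable

lemma frac_laplacian_eq:
  "frac_laplacian \<alpha> f x = (LINT z|lborel. levy_remainder f x z * levy_kernel \<alpha> z)"
  unfolding frac_laplacian_def levy_kernel_def[symmetric] levy_remainder_def[symmetric]
    set_lebesgue_integral_def
  by (rule Bochner_Integration.integral_cong) (auto simp: indicator_def)

text \<open>The function is the sum of its restriction to the positive half-line and the reflection
  of that restriction. The origin lies in neither half, and \<open>f 0 = 0\<close> makes the
  decomposition exact at every point.\<close>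

lemma lborel_integrable_even:
  fixes f :: "real \<Rightarrow> real"
  assumes "\<And>x. f (- x) = f x" and "set_integrable lborel {0<..} f" and "f 0 = 0"
  shows "integrable lborel f"
proof -
  have *: "integrable lborel (\<lambda>x. indicator {0<..} x * f x)"
    using assms(2) by (simp add: set_integrable_def)
  have "integrable lborel (\<lambda>x. indicator {0<..} (- x) * f (- x))"
    using lborel_integrable_real_affine[OF *, of "-1" 0] by simp
  with * have "integrable lborel (\<lambda>x. indicator {0<..} x * f x + indicator {0<..} (- x) * f (- x))"
    by (rule Bochner_Integration.integrable_add)
  also have "(\<lambda>x. indicator {0<..} x * f x + indicator {0<..} (- x) * f (- x)) = f"
    using assms(1,3) by (auto simp: fun_eq_iff indicator_def not_less intro: order.antisym)
  finally show ?thesis .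
qed

text \<open>For nonnegative functions gauge integrability is absolute integrability, and Borel
  measurability brings it down from the completed measure. This transfers the gauge integrals of
  powers to \<open>lborel\<close>.\<close>

lemma nonneg_integrable_on_imp_set_integrable:
  fixes f :: "real \<Rightarrow> real"
  assumes "f integrable_on S" "\<And>x. x \<in> S \<Longrightarrow> 0 \<le> f x"
    and [measurable]: "S \<in> sets borel" "f \<in> borel_measurable borel"
  shows "set_integrable lborel S f"
proof -
  have "set_integrable lebesgue S f"
    using assms(1,2) absolutely_integrable_on_iff_nonneg by blast
  then show ?thesis
    unfolding set_integrable_def by (subst (asm) integrable_completion) auto
qed

text \<open>Near 0 the integrand is a multiple of \<open>z powr (1 - \<alpha>)\<close>, integrable
  because \<alpha> < 2; at infinity it is a multiple of \<open>z powr (- 1 - \<alpha>)\<close>,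
  integrable because \<alpha> > 0.\<close>

lemma levy_kernel_integrable:
  assumes "0 < \<alpha>" "\<alpha> < 2"
  shows "integrable lborel (\<lambda>z. min 1 (z\<^sup>2) * levy_kernel \<alpha> z)"
proof (rule lborel_integrable_even)
  let ?m = "\<lambda>z. min 1 (z\<^sup>2) * levy_kernel \<alpha> z"
  have near: "set_integrable lborel {0<..1} ?m"
  proof -
    have "set_integrable lborel {0<..1} (\<lambda>z. z powr (1 - \<alpha>))"
      using assms by (intro nonneg_integrable_on_imp_set_integrable integrable_on_powr_from_0') auto
    then have *: "set_integrable lborel {0<..1} (\<lambda>z. frac_const \<alpha> * z powr (1 - \<alpha>))"
      by (rule set_integrable_mult_right)
    have eq: "frac_const \<alpha> * z powr (1 - \<alpha>) = ?m z" if "z \<in> {0<..1}" for z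
    proof -
      have "z\<^sup>2 / z powr (1 + \<alpha>) = z powr (1 - \<alpha>)"
        using that by (simp flip: powr_numeral powr_diff)
      moreover have "min 1 (z\<^sup>2) = z\<^sup>2"
        using that by (simp add: power_le_one)
      moreover have "z\<^sup>2 * levy_kernel \<alpha> z = frac_const \<alpha> * (z\<^sup>2 / z powr (1 + \<alpha>))"
        using that by (simp add: levy_kernel_def)
      ultimately show ?thesis
        by simp
    qed
    have "set_integrable lborel {0<..1} (\<lambda>z. frac_const \<alpha> * z powr (1 - \<alpha>)) = set_integrable lborel {0<..1} ?m"
      by (rule set_integrable_cong) (rule refl refl eq; assumption?)+
    with * show ?thesis by simp
  qed
  have far: "set_integrable lborel {1..} ?m"
  proof -
    have "set_integrable lborel {1..} (\<lambda>z. z powr (- 1 - \<alpha>))"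
      using assms has_integral_powr_to_inf[of "- 1 - \<alpha>" 1]
      by (intro nonneg_integrable_on_imp_set_integrable) auto
    then have *: "set_integrable lborel {1..} (\<lambda>z. frac_const \<alpha> * z powr (- 1 - \<alpha>))"
      by (rule set_integrable_mult_right)
    have eq: "frac_const \<alpha> * z powr (- 1 - \<alpha>) = ?m z" if "z \<in> {1..}" for z
    proof -
      have "z powr (- 1 - \<alpha>) = 1 / z powr (1 + \<alpha>)"
        by (metis minus_add minus_diff_commute powr_minus_divide uminus_add_conv_diff)
      moreover have "min 1 (z\<^sup>2) = 1"
        using that by simp
      ultimately show ?thesis
        using that by (simp add: levy_kernel_def)
    qed
    have "set_integrable lborel {1..} (\<lambda>z. frac_const \<alpha> * z powr (- 1 - \<alpha>)) = set_integrable lborel {1..} ?m"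
      by (rule set_integrable_cong) (rule refl refl eq; assumption?)+
    with * show ?thesis by simp
  qed
  have "{0<..} = {0<..1} \<union> {1::real..}" by auto
  then show "set_integrable lborel {0<..} ?m"
    using set_integrable_Un[OF near far] by simp
qed simp_all

text \<open>Small jumps are controlled by the supremum of the second derivative, large ones by twice
  the supremum of \<open>f\<close>. The constant does not depend on \<open>x\<close>, as the
  domination on the plane requires.\<close>

lemma levy_remainder_bound:
  assumes f: "f \<in> test_functions"
  obtains M where "\<And>x z. \<bar>levy_remainder f x z\<bar> \<le> M * min 1 (z\<^sup>2)"
proof -
  obtain M0 where M0: "\<And>x. \<bar>f x\<bar> \<le> M0" "0 \<le> M0"
    by (rule test_functions_bounded[OF f]) blast
  obtain M2 where M2: "\<And>x. \<bar>deriv (deriv f) x\<bar> \<le> M2" "0 \<le> M2"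
    by (rule test_functions_bounded[OF test_functions_deriv[OF test_functions_deriv[OF f]]]) blast
  have sm: "smooth f" "smooth (deriv f)"
    using f by (auto intro: test_functions_smooth smooth_deriv)
  have D1: "\<bar>deriv f y - deriv f x\<bar> \<le> M2 * \<bar>y - x\<bar>" for x y
    using field_differentiable_bound[of UNIV "deriv f" "deriv (deriv f)" M2 y x] M2
    by (auto intro: smooth_DERIV[OF sm(2)])
  have T: "\<bar>f (x + z) - f x - deriv f x * z\<bar> \<le> M2 * z\<^sup>2" for x z
  proof -
    \<comment> \<open>The mean value inequality is applied to \<open>f y - deriv f x * y\<close>,
      whose derivative is at most \<open>M2 * \<bar>z\<bar>\<close> in absolute value on the
      segment.\<close>
    have "\<bar>(f (x + z) - deriv f x * (x + z)) - (f x - deriv f x * x)\<bar> \<le> (M2 * \<bar>z\<bar>) * \<bar>(x + z) - x\<bar>"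
      unfolding real_norm_def[symmetric]
    proof (rule field_differentiable_bound[of "closed_segment x (x + z)"
          "\<lambda>y. f y - deriv f x * y" "\<lambda>y. deriv f y - deriv f x"])
      fix y assume y: "y \<in> closed_segment x (x + z)"
      show "((\<lambda>y. f y - deriv f x * y) has_field_derivative deriv f y - deriv f x)
          (at y within closed_segment x (x + z))"
        by (rule DERIV_subset[where s = UNIV])
           (auto intro!: derivative_eq_intros smooth_DERIV[OF sm(1)])
      have "\<bar>y - x\<bar> \<le> \<bar>z\<bar>"
        using y segment_bound1[OF y] by (simp add: abs_minus_commute)
      then show "norm (deriv f y - deriv f x) \<le> M2 * norm z"
        using D1[of y x] M2(2) by (simp add: order_trans[OF _ mult_left_mono])
    qed auto
    then show ?thesis by (simp add: power2_eq_square algebra_simps abs_mult_self_eq)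
  qed
  have "\<bar>levy_remainder f x z\<bar> \<le> (M2 + 2 * M0) * min 1 (z\<^sup>2)" for x z
  proof (cases "\<bar>z\<bar> \<le> 1")
    case True
    then have "min 1 (z\<^sup>2) = z\<^sup>2" by (simp add: abs_square_le_1 min_absorb2)
    with True T[of x z] M0(2) show ?thesis
      by (simp add: levy_remainder_def distrib_right add_increasing2)
  next
    case False
    then have "1 \<le> z\<^sup>2" using one_le_power[of "\<bar>z\<bar>" 2] by simp
    with False M0(1)[of "x + z"] M0(1)[of x] M2(2) show ?thesis
      by (simp add: levy_remainder_def min_def)
  qed
  then show ?thesis by (rule that)
qed

lemma levy_remainder_measurable:
  assumes "f \<in> test_functions"
  shows "(\<lambda>(x, z). levy_remainder f x z) \<in> borel_measurable (borel \<Otimes>\<^sub>M borel)"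
proof -
  have [measurable]: "f \<in> borel_measurable borel" "deriv f \<in> borel_measurable borel"
    using test_functions_smooth[OF assms] by (auto intro!: smooth_borel_measurable smooth_deriv)
  show ?thesis unfolding levy_remainder_def by measurable
qed

section \<open>Symmetry of the fractional Laplacian\<close>

text \<open>The uniform remainder bound dominates the integrand by a product of an integrable
  function of \<open>z\<close> and \<open>\<bar>g x\<bar>\<close>. The second claim is the
  hypothesis of Fubini.\<close>

lemma levy_remainder_times_kernel_integrable:
  assumes \<alpha>: "0 < \<alpha>" "\<alpha> < 2" and f: "f \<in> test_functions" and g: "g \<in> test_functions"
  shows "integrable lborel (\<lambda>z. levy_remainder f x z * levy_kernel \<alpha> z)" (is ?one)
    and "integrable (lborel \<Otimes>\<^sub>M lborel) (\<lambda>(x, z). levy_remainder f x z * levy_kernel \<alpha> z * g x)" (is ?two)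
proof -
  obtain M where M: "\<And>x z. \<bar>levy_remainder f x z\<bar> \<le> M * min 1 (z\<^sup>2)"
    by (rule levy_remainder_bound[OF f]) blast
  note [measurable] = levy_remainder_measurable[OF f]
    smooth_borel_measurable[OF test_functions_smooth[OF g]]
  let ?m = "\<lambda>z. min 1 (z\<^sup>2) * levy_kernel \<alpha> z"
  have int_m: "integrable lborel (\<lambda>z. M * ?m z)"
    using levy_kernel_integrable[OF \<alpha>] by simp
  have bound: "\<bar>levy_remainder f x z * levy_kernel \<alpha> z\<bar> \<le> M * ?m z" for x z
    using mult_right_mono[OF M[of x z] levy_kernel_nonneg[OF \<alpha>, of z]]
    by (simp add: abs_mult levy_kernel_nonneg[OF \<alpha>] mult.assoc)
  show ?one
    by (rule Bochner_Integration.integrable_bound[OF int_m])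
       (use bound in \<open>auto intro: order_trans[OF _ abs_ge_self]\<close>)
  have nn: "0 \<le> M * ?m z" for z
    using order_trans[OF abs_ge_zero bound] .
  have "integrable (lborel \<Otimes>\<^sub>M lborel) (\<lambda>(x, z). g x * (M * ?m z))"
    by (rule lborel_pair.Fubini_integrable)
       (use test_functions_integrable[OF g] int_m nn in \<open>auto simp: abs_mult\<close>)
  then show ?two
  proof (rule Bochner_Integration.integrable_bound, measurable)
    have "\<bar>levy_remainder f x z * levy_kernel \<alpha> z * g x\<bar> \<le> \<bar>g x * (M * ?m z)\<bar>" for x z
      using mult_right_mono[OF order_trans[OF bound abs_ge_self], of "\<bar>g x\<bar>" x z]
      by (simp only: abs_mult[of _ "g x"] abs_mult[of "g x"] mult.commute[of _ "\<bar>g x\<bar>"])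
    then show "AE p in lborel \<Otimes>\<^sub>M lborel.
        norm (case p of (x, z) \<Rightarrow> levy_remainder f x z * levy_kernel \<alpha> z * g x)
          \<le> norm (case p of (x, z) \<Rightarrow> g x * (M * ?m z))"
      by (simp only: real_norm_def split_beta) simp
  qed
qed

lemma frac_laplacian_mult_integrable:
  assumes "0 < \<alpha>" "\<alpha> < 2" "f \<in> test_functions" "g \<in> test_functions"
  shows "integrable lborel (\<lambda>x. frac_laplacian \<alpha> f x * g x)"
  using lborel_pair.integrable_fst'[OF levy_remainder_times_kernel_integrable(2)[OF assms]]
  by (simp add: frac_laplacian_eq)

text \<open>Reflection turns the integral into its own negative. If the integral diverges, its
  default value 0 agrees with the claim.\<close>

lemma lborel_integral_odd:
  fixes f :: "real \<Rightarrow> real"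
  assumes "\<And>x. f (- x) = - f x" shows "(LINT x|lborel. f x) = 0"
  using lborel_integral_real_affine[of "-1" f 0] assms by simp

text \<open>By Fubini the difference of the two sides is the integral of the even kernel against an
  odd function of the jump \<open>z\<close>: translating by \<open>z\<close> exchanges the roles of \<open>f\<close> and \<open>g\<close>.\<close>

lemma frac_laplacian_symmetric:
  assumes \<alpha>: "0 < \<alpha>" "\<alpha> < 2" and f: "f \<in> test_functions" and g: "g \<in> test_functions"
  shows "(LINT x|lborel. frac_laplacian \<alpha> f x * g x) = (LINT x|lborel. f x * frac_laplacian \<alpha> g x)"
proof -
  \<comment> \<open>The integral over positions for a fixed jump \<open>z\<close>; Fubini puts the
    integration over jumps outermost.\<close>
  define I where "I f g z = (LINT x|lborel. levy_remainder f x z * g x)" for f g z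
  have *: "(LINT x|lborel. frac_laplacian \<alpha> f x * g x) = (LINT z|lborel. I f g z * levy_kernel \<alpha> z)"
    "integrable lborel (\<lambda>z. I f g z * levy_kernel \<alpha> z)"
    if fg: "f \<in> test_functions" "g \<in> test_functions" for f g
  proof -
    note int = levy_remainder_times_kernel_integrable(2)[OF \<alpha> fg]
    have inner: "(LINT x|lborel. levy_remainder f x z * levy_kernel \<alpha> z * g x) = I f g z * levy_kernel \<alpha> z" for z
      unfolding I_def by (subst integral_mult_left_zero[symmetric]) (simp add: mult_ac)
    show "(LINT x|lborel. frac_laplacian \<alpha> f x * g x) = (LINT z|lborel. I f g z * levy_kernel \<alpha> z)"
      using lborel_pair.Fubini_integral[OF int] by (simp add: inner frac_laplacian_eq)
    show "integrable lborel (\<lambda>z. I f g z * levy_kernel \<alpha> z)"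
      using lborel_pair.integrable_snd[OF int] by (simp add: inner)
  qed
  define S where "S f g z = (LINT x|lborel. f (x + z) * g x)" for f g :: "real \<Rightarrow> real" and z
  have S_minus: "S f g (- z) = S g f z" for f g z
    unfolding S_def by (subst lborel_integral_real_affine[of 1 _ z]) (simp_all add: ac_simps)
  have I_eq: "I f g z = S f g z - (LINT x|lborel. f x * g x)
      - (LINT x|lborel. deriv f x * g x) * (z * indicator {z. \<bar>z\<bar> \<le> 1} z)"
    if fg: "f \<in> test_functions" "g \<in> test_functions" for f g z
  proof -
    note sm = test_functions_smooth[OF fg(1)]
    have "continuous_on UNIV (\<lambda>x. f (x + z))"
      using smooth_continuous_on[OF smooth_affine[OF sm, of 1 z]] by simp
    then have "integrable lborel (\<lambda>x. f (x + z) * g x)"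
      by (intro test_functions_mult_integrable fg)
    moreover have "integrable lborel (\<lambda>x. f x * g x)" "integrable lborel (\<lambda>x. deriv f x * g x)"
      by (intro test_functions_mult_integrable fg smooth_continuous_on sm smooth_deriv)+
    moreover have "I f g z = (LINT x|lborel. f (x + z) * g x - f x * g x
        - deriv f x * g x * (z * indicator {z. \<bar>z\<bar> \<le> 1} z))"
      unfolding I_def levy_remainder_def by (simp add: algebra_simps)
    ultimately show ?thesis
      by (simp add: S_def)
  qed
  \<comment> \<open>In the difference the symmetric term, the integral of \<open>f * g\<close>,
    cancels. Under \<open>z\<close> to \<open>- z\<close> the two correlations \<open>S f g\<close>
    and \<open>S g f\<close> trade places, and the gradient correction changes sign.\<close>
  have odd: "I f g (- z) - I g f (- z) = - (I f g z - I g f z)" for z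
  proof -
    have "indicator {z. \<bar>z\<bar> \<le> 1} (- z) = (indicator {z. \<bar>z\<bar> \<le> 1} z :: real)"
      by (simp add: indicator_def)
    then show ?thesis
      by (simp add: I_eq f g S_minus mult.commute[of "f _" "g _"])
  qed
  have "(LINT x|lborel. frac_laplacian \<alpha> f x * g x) - (LINT x|lborel. frac_laplacian \<alpha> g x * f x)
      = (LINT z|lborel. I f g z * levy_kernel \<alpha> z - I g f z * levy_kernel \<alpha> z)"
    by (simp add: * f g)
  also have "\<dots> = 0"
    by (rule lborel_integral_odd) (simp add: odd flip: left_diff_distrib, simp add: algebra_simps)
  finally show ?thesis by (simp add: mult.commute)
qed

text \<open>The weight \<open>1 / a\<close> cancels the coefficient \<open>a\<close>, which leaves
  the Lebesgue pairing of the fractional Laplacian. Continuity of \<open>1 / a\<close> makes the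
  measure locally finite, so test functions are square integrable.\<close>

lemma reversible_inverse_density:
  assumes \<alpha>: "0 < \<alpha>" "\<alpha> < 2" and a: "continuous_on UNIV a" "\<forall>x. a x > 0" and b: "\<forall>x. b x = 0"
  shows "reversible_measure (levy_operator \<alpha> a b) (density lborel (\<lambda>x. ennreal (inverse (a x))))"
proof -
  let ?\<mu> = "density lborel (\<lambda>x. ennreal (inverse (a x)))"
  have cinv: "continuous_on UNIV (\<lambda>x. inverse (a x))"
    using a by (intro continuous_on_inverse) (auto simp: less_imp_neq[symmetric])
  have [measurable]: "a \<in> borel_measurable borel"
    using a(1) by (rule borel_measurable_continuous_onI)
  have nn': "0 \<le> a x" for x
    using a(2) by (simp add: less_imp_le)
  have a0: "a x \<noteq> 0" for x
    using a(2) by (metis less_irrefl)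
  have pair: "integrable ?\<mu> (\<lambda>x. levy_operator \<alpha> a b f x * g x)"
    "(LINT x|?\<mu>. levy_operator \<alpha> a b f x * g x) = (LINT x|lborel. frac_laplacian \<alpha> f x * g x)"
    if fg: "f \<in> test_functions" "g \<in> test_functions" for f g
  proof -
    \<comment> \<open>Measurability of the pairing is read off from the integrability that Fubini
      provides.\<close>
    have [measurable]: "(\<lambda>x. levy_operator \<alpha> a b f x * g x) \<in> borel_measurable borel"
    proof -
      have "(\<lambda>x. a x * (frac_laplacian \<alpha> f x * g x)) \<in> borel_measurable borel"
        using borel_measurable_integrable[OF frac_laplacian_mult_integrable[OF \<alpha> fg]] by measurable
      then show ?thesis
        by (simp add: levy_operator_def b mult.assoc)
    qed
    have eq: "inverse (a x) * (levy_operator \<alpha> a b f x * g x) = frac_laplacian \<alpha> f x * g x" for x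
      using a0[of x] by (simp add: levy_operator_def b)
    show "integrable ?\<mu> (\<lambda>x. levy_operator \<alpha> a b f x * g x)"
      using frac_laplacian_mult_integrable[OF \<alpha> fg]
      by (subst integrable_real_density) (simp_all add: nn' eq)
    show "(LINT x|?\<mu>. levy_operator \<alpha> a b f x * g x) = (LINT x|lborel. frac_laplacian \<alpha> f x * g x)"
      by (subst integral_real_density) (simp_all add: nn' eq)
  qed
  have "emeasure ?\<mu> UNIV \<noteq> 0"
  proof
    assume "emeasure ?\<mu> UNIV = 0"
    then have "(\<integral>\<^sup>+x. ennreal (inverse (a x)) \<partial>lborel) = 0"
      by (simp add: emeasure_density)
    then have "AE x in lborel. ennreal (inverse (a x)) = 0"
      by (subst (asm) nn_integral_0_iff_AE) auto
    then have "AE x::real in lborel. False"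
      by (rule AE_mp) (use a(2) in \<open>auto simp: ennreal_eq_0_iff not_le\<close>)
    then show False by (simp add: eventually_False ae_filter_eq_bot_iff)
  qed
  moreover have "test_functions \<subseteq> L2_functions ?\<mu>"
  proof
    fix f assume f: "f \<in> test_functions"
    note sm = test_functions_smooth[OF f]
    note [measurable] = smooth_borel_measurable[OF sm]
    have "integrable lborel (\<lambda>x. (inverse (a x) * f x) * f x)"
      by (intro test_functions_mult_integrable f continuous_on_mult cinv smooth_continuous_on sm)
    then have "integrable ?\<mu> (\<lambda>x. (f x)\<^sup>2)"
      by (subst integrable_real_density) (simp_all add: nn' power2_eq_square mult.assoc)
    then show "f \<in> L2_functions ?\<mu>"
      by (simp add: L2_functions_def)
  qed
  moreover have "integrable ?\<mu> (\<lambda>x. f x * levy_operator \<alpha> a b g x)" 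
    "L2_inner ?\<mu> (levy_operator \<alpha> a b f) g = L2_inner ?\<mu> f (levy_operator \<alpha> a b g)"
    if fg: "f \<in> test_functions" "g \<in> test_functions" for f g
    using pair[OF fg] pair[OF fg(2,1)] frac_laplacian_symmetric[OF \<alpha> fg]
    by (simp_all add: L2_inner_def mult.commute)
  ultimately show ?thesis
    using pair by (simp add: reversible_measure_def)
qed

section \<open>Reversible measures\<close>

text \<open>At a zero of a nonnegative \<open>f\<close> the derivative vanishes as well, so the
  remainder reduces to \<open>f (x + z)\<close>. The integrand is then nonnegative and can be
  handled in \<open>ennreal\<close>.\<close>

lemma frac_laplacian_off_support:
  assumes \<alpha>: "0 < \<alpha>" "\<alpha> < 2" and f: "f \<in> test_functions" "\<And>y. 0 \<le> f y" "f x = 0"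
  shows "0 \<le> frac_laplacian \<alpha> f x"
    and "ennreal (frac_laplacian \<alpha> f x) = (\<integral>\<^sup>+y. ennreal (f y * levy_kernel \<alpha> (y - x)) \<partial>lborel)"
proof -
  have rem: "levy_remainder f x z = f (x + z)" for z
    using deriv_eq_0_if_nonneg[OF f] f(3) by (simp add: levy_remainder_def)
  note [measurable] = smooth_borel_measurable[OF test_functions_smooth[OF f(1)]]
  have nn: "0 \<le> f (x + z) * levy_kernel \<alpha> z" for z
    by (simp add: f levy_kernel_nonneg[OF \<alpha>])
  show "0 \<le> frac_laplacian \<alpha> f x"
    by (simp add: frac_laplacian_eq rem nn integral_nonneg)
  have "ennreal (frac_laplacian \<alpha> f x) = (\<integral>\<^sup>+z. ennreal (f (x + z) * levy_kernel \<alpha> z) \<partial>lborel)"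
    using levy_remainder_times_kernel_integrable(1)[OF \<alpha> f(1) f(1), of x]
    by (simp add: frac_laplacian_eq rem nn nn_integral_eq_integral)
  also have "\<dots> = (\<integral>\<^sup>+y. ennreal (f y * levy_kernel \<alpha> (y - x)) \<partial>lborel)"
    by (subst nn_integral_real_affine[of "\<lambda>y. ennreal (f y * levy_kernel \<alpha> (y - x))" 1 x]) simp_all
  finally show "ennreal (frac_laplacian \<alpha> f x) = (\<integral>\<^sup>+y. ennreal (f y * levy_kernel \<alpha> (y - x)) \<partial>lborel)" .
qed

text \<open>A nonempty open interval has positive length, so it cannot lie inside a null
  set.\<close>

lemma lborel_AE_obtain:
  fixes l u :: real
  assumes "AE x in lborel. P x" "l < u"
  obtains x where "l < x" "x < u" "P x"
proof -
  have "\<exists>x. l < x \<and> x < u \<and> P x"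
  proof (rule ccontr)
    assume "\<not> ?thesis"
    then have "AE x in lborel. x \<notin> {l<..<u}"
      using assms(1) by (auto elim: AE_mp)
    then have "{l<..<u} \<in> null_sets lborel"
      by (subst AE_iff_null_sets) auto
    then show False using assms(2) by (auto simp: null_sets_def)
  qed
  then show ?thesis using that by blast
qed

section \<open>Measures on the plane tested by products of bumps\<close>

lemma box_Pair: "box (l, l') (u, u') = {l<..<u} \<times> {l'<..<u'}" for l l' u u' :: real
  by (auto simp: box_def Basis_prod_def)

lemma indicator_box_eq_SUP_bump:
  "indicator (box (l, l') (u, u')) (x, y) = (SUP n. ennreal (bump n l u x * bump n l' u' y))"
proof (rule LIMSEQ_unique)
  have "(\<lambda>n. bump n l u x * bump n l' u' y) \<longlonglongrightarrow> indicator {l<..<u} x * indicator {l'<..<u'} y"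
    by (intro tendsto_mult bump_tendsto)
  then have "(\<lambda>n. ennreal (bump n l u x * bump n l' u' y))
      \<longlonglongrightarrow> ennreal (indicator {l<..<u} x * indicator {l'<..<u'} y)"
    by (rule tendsto_ennrealI)
  also have "ennreal (indicator {l<..<u} x * indicator {l'<..<u'} y)
      = indicator (box (l, l') (u, u')) (x, y)"
    by (simp add: box_Pair indicator_def)
  finally show "(\<lambda>n. ennreal (bump n l u x * bump n l' u' y))
      \<longlonglongrightarrow> indicator (box (l, l') (u, u')) (x, y)" .
  show "(\<lambda>n. ennreal (bump n l u x * bump n l' u' y))
      \<longlonglongrightarrow> (SUP n. ennreal (bump n l u x * bump n l' u' y))"
    by (intro LIMSEQ_SUP incseq_SucI ennreal_leI mult_mono bump_mono) auto
qed

text \<open>Monotone convergence along increasing bumps. Boxes generate the Borel sets, so densities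
  on the plane can be compared through smooth product test functions, to which symmetry
  applies.\<close>

lemma emeasure_density_box:
  fixes F :: "real \<times> real \<Rightarrow> ennreal"
  assumes [measurable]: "F \<in> borel_measurable borel"
  shows "emeasure (density lborel F) (box (l, l') (u, u')) =
    (SUP n. \<integral>\<^sup>+q. F q * ennreal (bump n l u (fst q) * bump n l' u' (snd q)) \<partial>lborel)"
proof -
  have [measurable]: "bump n c d \<in> borel_measurable borel" for n c d
    by (rule smooth_borel_measurable[OF smooth_bump])
  have [measurable]: "F \<in> borel_measurable (borel \<Otimes>\<^sub>M borel)"
    by (simp add: borel_prod)
  have "emeasure (density lborel F) (box (l, l') (u, u'))
      = (\<integral>\<^sup>+q. F q * indicator (box (l, l') (u, u')) q \<partial>lborel)"
    by (simp add: emeasure_density)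
  also have "\<dots> = (\<integral>\<^sup>+q. (SUP n. F q * ennreal (bump n l u (fst q) * bump n l' u' (snd q))) \<partial>lborel)"
    by (intro nn_integral_cong)
       (simp only: indicator_box_eq_SUP_bump SUP_mult_left_ennreal split_paired_all fst_conv snd_conv)
  also have "\<dots> = (SUP n. \<integral>\<^sup>+q. F q * ennreal (bump n l u (fst q) * bump n l' u' (snd q)) \<partial>lborel)"
  proof (rule nn_integral_monotone_convergence_SUP)
    show "incseq (\<lambda>n q. F q * ennreal (bump n l u (fst q) * bump n l' u' (snd q)))"
      by (intro incseq_SucI le_funI mult_left_mono ennreal_leI mult_mono bump_mono) auto
  qed (simp add: borel_prod[symmetric])
  finally show ?thesis .
qed

section \<open>Determining the density of a reversible measure\<close>

text \<open>The density is \<open>ennreal\<close>-valued: Radon-Nikodym is applied to a measure not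
  known to be sigma-finite and may return infinite values. Finiteness almost everywhere comes out in
  \<open>density_eq_inverse\<close>.\<close>

locale reversible_density =
  fixes \<alpha> :: real and a b :: "real \<Rightarrow> real" and p :: "real \<Rightarrow> ennreal"
  assumes alpha: "0 < \<alpha>" "\<alpha> < 2"
    and a_cont: "continuous_on UNIV a" and a_pos: "\<And>x. a x > 0"
    and p_meas [measurable]: "p \<in> borel_measurable borel"
    and rev: "reversible_measure (levy_operator \<alpha> a b) (density lborel p)"
begin

definition W :: "real \<Rightarrow> ennreal" where "W x = p x * ennreal (a x)"

lemma a_meas [measurable]: "a \<in> borel_measurable borel"
  using a_cont by (rule borel_measurable_continuous_onI)

lemma W_meas [measurable]: "W \<in> borel_measurable borel"
  unfolding W_def[abs_def] by measurable

text \<open>The pairing of the jump part applied to \<open>f\<close> with \<open>g\<close>, for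
  functions with disjoint supports. As a nonnegative integral it makes sense before \<open>p\<close>
  is known to be finite.\<close>

definition jump_form :: "(real \<Rightarrow> real) \<Rightarrow> (real \<Rightarrow> real) \<Rightarrow> ennreal" where
  "jump_form f g =
     (\<integral>\<^sup>+x. \<integral>\<^sup>+y. W x * ennreal (g x * f y * levy_kernel \<alpha> (y - x)) \<partial>lborel \<partial>lborel)"

lemma jump_form_eq_L2_inner:
  assumes f: "f \<in> test_functions" "\<And>x. 0 \<le> f x" and g: "g \<in> test_functions" "\<And>x. 0 \<le> g x"
    and disj: "\<And>x. f x = 0 \<or> g x = 0"
  shows "jump_form f g = ennreal (L2_inner (density lborel p) (levy_operator \<alpha> a b f) g)"
proof -
  note [measurable] = smooth_borel_measurable[OF test_functions_smooth[OF f(1)]]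
    smooth_borel_measurable[OF test_functions_smooth[OF g(1)]]
  have int: "integrable (density lborel p) (\<lambda>x. levy_operator \<alpha> a b f x * g x)"
    using rev f g by (auto simp: reversible_measure_def)
  then have [measurable]: "(\<lambda>x. levy_operator \<alpha> a b f x * g x) \<in> borel_measurable borel"
    using borel_measurable_integrable by force
  \<comment> \<open>Either \<open>g x = 0\<close>, or \<open>f x = 0\<close> and hence
    \<open>deriv f x = 0\<close>; in both cases the drift contributes nothing.\<close>
  have eq: "levy_operator \<alpha> a b f x * g x = a x * (g x * frac_laplacian \<alpha> f x)" for x
    using disj[of x] deriv_eq_0_if_nonneg[OF f, of x] by (auto simp: levy_operator_def)
  have nn: "0 \<le> g x * frac_laplacian \<alpha> f x" for x
    using disj[of x] frac_laplacian_off_support(1)[OF alpha f, of x] g(2)[of x] by auto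
  have "(\<integral>\<^sup>+y. W x * ennreal (g x * f y * levy_kernel \<alpha> (y - x)) \<partial>lborel)
      = p x * ennreal (levy_operator \<alpha> a b f x * g x)" for x
  proof (cases "g x = 0")
    case False
    then have fx: "f x = 0" using disj[of x] by simp
    have "(\<integral>\<^sup>+y. W x * ennreal (g x * f y * levy_kernel \<alpha> (y - x)) \<partial>lborel)
        = (\<integral>\<^sup>+y. W x * ennreal (g x) * ennreal (f y * levy_kernel \<alpha> (y - x)) \<partial>lborel)"
      by (intro nn_integral_cong)
         (simp add: f g levy_kernel_nonneg[OF alpha] mult.assoc flip: ennreal_mult)
    also have "\<dots> = W x * ennreal (g x) * ennreal (frac_laplacian \<alpha> f x)"
      by (simp add: nn_integral_cmult frac_laplacian_off_support(2)[OF alpha f fx])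
    also have "\<dots> = p x * ennreal (levy_operator \<alpha> a b f x * g x)"
      using frac_laplacian_off_support(1)[OF alpha f fx] g(2)[of x] a_pos[of x]
      by (simp add: W_def eq ennreal_mult mult.assoc less_imp_le)
    finally show ?thesis .
  qed simp
  then have "jump_form f g = (\<integral>\<^sup>+x. p x * ennreal (levy_operator \<alpha> a b f x * g x) \<partial>lborel)"
    by (simp add: jump_form_def)
  also have "\<dots> = (\<integral>\<^sup>+x. ennreal (levy_operator \<alpha> a b f x * g x) \<partial>density lborel p)"
    by (simp add: nn_integral_density)
  also have "\<dots> = ennreal (LINT x|density lborel p. levy_operator \<alpha> a b f x * g x)"
    by (rule nn_integral_eq_integral[OF int])
       (use nn a_pos in \<open>auto simp: eq less_imp_le intro!: AE_I2\<close>)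
  finally show ?thesis by (simp add: L2_inner_def)
qed

lemma jump_form_commute:
  assumes "f \<in> test_functions" "\<And>x. 0 \<le> f x" "g \<in> test_functions" "\<And>x. 0 \<le> g x"
    and "\<And>x. f x = 0 \<or> g x = 0"
  shows "jump_form f g = jump_form g f" and "jump_form f g \<noteq> \<infinity>"
proof -
  have "L2_inner (density lborel p) (levy_operator \<alpha> a b f) g =
      L2_inner (density lborel p) f (levy_operator \<alpha> a b g)"
    using rev assms by (auto simp: reversible_measure_def)
  also have "\<dots> = L2_inner (density lborel p) (levy_operator \<alpha> a b g) f"
    by (simp add: L2_inner_def mult.commute)
  finally show "jump_form f g = jump_form g f"
    using assms(5) by (simp add: jump_form_eq_L2_inner assms disj_commute)
  show "jump_form f g \<noteq> \<infinity>"
    by (simp add: jump_form_eq_L2_inner[OF assms])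
qed

text \<open>The two orders of integration, combined with evenness of the kernel. Applying the second
  form to \<open>jump_form g f\<close> gives the same weight as the first form for
  \<open>jump_form f g\<close>; only the point at which \<open>W\<close> is evaluated
  differs.\<close>

lemma jump_form_eq_pair_integrals:
  assumes f: "f \<in> borel_measurable borel" and g: "g \<in> borel_measurable borel"
  shows "jump_form f g =
      (\<integral>\<^sup>+q. W (fst q) * ennreal (g (fst q) * f (snd q) * levy_kernel \<alpha> (snd q - fst q)) \<partial>lborel)"
    and "jump_form f g =
      (\<integral>\<^sup>+q. W (snd q) * ennreal (f (fst q) * g (snd q) * levy_kernel \<alpha> (snd q - fst q)) \<partial>lborel)"
proof -
  note [measurable] = f g
  show "jump_form f g =
      (\<integral>\<^sup>+q. W (fst q) * ennreal (g (fst q) * f (snd q) * levy_kernel \<alpha> (snd q - fst q)) \<partial>lborel)"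
    unfolding jump_form_def lborel_prod[symmetric]
    by (subst lborel.nn_integral_fst[symmetric]) simp_all
  show "jump_form f g =
      (\<integral>\<^sup>+q. W (snd q) * ennreal (f (fst q) * g (snd q) * levy_kernel \<alpha> (snd q - fst q)) \<partial>lborel)"
  proof -
    have flip: "levy_kernel \<alpha> (t - s) = levy_kernel \<alpha> (s - t)" for s t
      using levy_kernel_minus[of \<alpha> "s - t"] by simp
    then show ?thesis
      unfolding jump_form_def lborel_prod[symmetric]
      by (subst lborel_pair.nn_integral_snd[symmetric]) (simp_all add: flip mult.commute)
  qed
qed

text \<open>Symmetry for test functions increasing to the indicators of two disjoint intervals makes
  \<open>W x * k (y - x)\<close> and \<open>W y * k (y - x)\<close> densities of the same measure on the product. The weight
  \<open>bump 0 l u x * bump 0 l' u' y\<close> only serves to make this measure finite.\<close>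

lemma W_eq_AE_on_disjoint_intervals:
  assumes disj: "{l<..<u} \<inter> {l'<..<u'} = {}"
  shows "AE q in lborel. fst q \<in> {l<..<u} \<and> snd q \<in> {l'<..<u'} \<longrightarrow> W (fst q) = W (snd q)"
proof -
  let ?g = "bump 0 l u" and ?f = "bump 0 l' u'"
  have [measurable]: "bump n c d \<in> borel_measurable borel" for n c d
    by (rule smooth_borel_measurable[OF smooth_bump])
  define w where "w q = ennreal (?g (fst q) * ?f (snd q) * levy_kernel \<alpha> (snd q - fst q))" for q
  define F1 where "F1 q = W (fst q) * w q" for q
  define F2 where "F2 q = W (snd q) * w q" for q
  have [measurable]: "F1 \<in> borel_measurable borel" "F2 \<in> borel_measurable borel"
    unfolding F1_def[abs_def] F2_def[abs_def] w_def borel_prod[symmetric] by measurable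
  have commute: "jump_form f g = jump_form g f" "jump_form f g \<noteq> \<infinity>"
    if f: "f = (\<lambda>x. h x * ?f x)" and g: "g = (\<lambda>x. h' x * ?g x)"
      and h: "smooth h" "smooth h'" "\<And>x. 0 \<le> h x" "\<And>x. 0 \<le> h' x" for f g h h'
  proof -
    have "f x = 0 \<or> g x = 0" for x
      using disj by (auto simp: f g bump_eq_0_iff)
    moreover have "f \<in> test_functions" "g \<in> test_functions"
      unfolding f g by (intro test_functions_mult bump_test_function h)+
    ultimately show "jump_form f g = jump_form g f" "jump_form f g \<noteq> \<infinity>"
      using h jump_form_commute[of f g] by (simp_all add: f g)
  qed
  have M_eq: "density lborel F1 = density lborel F2"
  proof (rule measure_eqI_generator_eq)
    let ?E = "range (\<lambda>(a, b). box a b :: (real \<times> real) set)"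
    show "Int_stable ?E"
      by (auto simp: Int_stable_def box_Int_box)
    show "?E \<subseteq> Pow UNIV" "sets (density lborel F1) = sigma_sets UNIV ?E"
      "sets (density lborel F2) = sigma_sets UNIV ?E"
      by (simp_all add: borel_eq_box)
    let ?A = "\<lambda>n::nat. box (- (real n *\<^sub>R One)) (real n *\<^sub>R One) :: (real \<times> real) set"
    show "range ?A \<subseteq> ?E" "(\<Union>i. ?A i) = UNIV"
      unfolding UN_box_eq_UNIV by auto
    show "emeasure (density lborel F1) (?A i) \<noteq> \<infinity>" for i
    proof -
      have "emeasure (density lborel F1) (?A i) \<le> emeasure (density lborel F1) UNIV"
        by (rule emeasure_mono) auto
      also have "\<dots> = jump_form ?f ?g"
        by (simp add: emeasure_density jump_form_eq_pair_integrals(1) F1_def w_def)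
      also have "\<dots> < \<infinity>"
        using commute(2)[of ?f "\<lambda>_. 1" ?g "\<lambda>_. 1"] smooth_const by (simp add: top.not_eq_extremum)
      finally show ?thesis by simp
    qed
    fix X assume "X \<in> ?E"
    then obtain c d c' d' where X: "X = box (c, c') (d, d')" by auto
    \<comment> \<open>Bumps for an arbitrary box are multiplied by the fixed weights, which confines
      the products to the two disjoint intervals where symmetry of the jump form is
      available.\<close>
    let ?gn = "\<lambda>n x. bump n c d x * ?g x" and ?fn = "\<lambda>n x. bump n c' d' x * ?f x"
    have "(\<integral>\<^sup>+q. F1 q * ennreal (bump n c d (fst q) * bump n c' d' (snd q)) \<partial>lborel) =
        (\<integral>\<^sup>+q. F2 q * ennreal (bump n c d (fst q) * bump n c' d' (snd q)) \<partial>lborel)" for n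
    proof -
      have weight: "w q * ennreal (bump n c d (fst q) * bump n c' d' (snd q)) =
          ennreal (?gn n (fst q) * ?fn n (snd q) * levy_kernel \<alpha> (snd q - fst q))" for q
        by (simp add: w_def levy_kernel_nonneg[OF alpha] ac_simps flip: ennreal_mult)
      have "(\<integral>\<^sup>+q. F1 q * ennreal (bump n c d (fst q) * bump n c' d' (snd q)) \<partial>lborel) = jump_form (?fn n) (?gn n)"
        by (simp add: jump_form_eq_pair_integrals(1) F1_def mult.assoc weight)
      also have "\<dots> = jump_form (?gn n) (?fn n)"
        by (rule commute(1)[OF refl refl]) (auto intro: smooth_bump)
      also have "\<dots> = (\<integral>\<^sup>+q. F2 q * ennreal (bump n c d (fst q) * bump n c' d' (snd q)) \<partial>lborel)"
        by (simp add: jump_form_eq_pair_integrals(2) F2_def mult.assoc weight)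
      finally show ?thesis .
    qed
    then show "emeasure (density lborel F1) X = emeasure (density lborel F2) X"
      unfolding X by (simp add: emeasure_density_box)
  qed
  have "AE q in lborel. F1 q = F2 q"
    by (rule sigma_finite_measure.density_unique[OF sigma_finite_lborel])
       (simp_all add: M_eq)
  then show ?thesis
  proof eventually_elim
    case (elim q)
    show ?case
    proof
      assume q: "fst q \<in> {l<..<u} \<and> snd q \<in> {l'<..<u'}"
      then have "snd q - fst q \<noteq> 0" using disj by auto
      \<comment> \<open>Disjointness keeps \<open>q\<close> off the diagonal, so the weight is
        positive and finite and can be cancelled.\<close>
      then have "0 < ?g (fst q) * ?f (snd q) * levy_kernel \<alpha> (snd q - fst q)"
        using q by (simp add: bump_pos_iff levy_kernel_pos[OF alpha])
      then have "w q \<noteq> 0" "w q \<noteq> \<infinity>"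
        by (simp_all add: w_def ennreal_eq_0_iff)
      then show "W (fst q) = W (snd q)"
        using elim by (simp add: F1_def F2_def mult.commute[of _ "w q"] ennreal_mult_cancel_left)
    qed
  qed
qed

text \<open>Points of one interval are compared through a reference point outside it:
  \<open>W\<close> on \<open>(- N, N)\<close> equals its value at a suitable \<open>x\<close> in
  \<open>(N, N + 1)\<close>. These intervals all overlap, so the values for different
  \<open>N\<close> coincide.\<close>

lemma W_constant:
  obtains c where "AE x in lborel. W x = c"
proof -
  have "\<exists>c. AE y in lborel. y \<in> {- real (Suc n)<..<real (Suc n)} \<longrightarrow> W y = c" for n
  proof -
    let ?N = "real (Suc n)"
    have "AE q in lborel \<Otimes>\<^sub>M lborel. fst q \<in> {?N<..<?N + 1} \<and> snd q \<in> {- ?N<..<?N} \<longrightarrow> W (fst q) = W (snd q)"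
      unfolding lborel_prod by (rule W_eq_AE_on_disjoint_intervals) auto
    then have "AE x in lborel. AE y in lborel. x \<in> {?N<..<?N + 1} \<and> y \<in> {- ?N<..<?N} \<longrightarrow> W x = W y"
      using lborel_pair.AE_pair by force
    then obtain x where "?N < x" "x < ?N + 1"
      "AE y in lborel. x \<in> {?N<..<?N + 1} \<and> y \<in> {- ?N<..<?N} \<longrightarrow> W x = W y"
      by (rule lborel_AE_obtain[of _ ?N "?N + 1"]) auto
    then have "AE y in lborel. y \<in> {- ?N<..<?N} \<longrightarrow> W y = W x"
      by (auto elim: AE_mp)
    then show ?thesis by blast
  qed
  then obtain c where c: "\<And>n. AE y in lborel. y \<in> {- real (Suc n)<..<real (Suc n)} \<longrightarrow> W y = c n"
    by metis
  have c0: "c n = c 0" for n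
  proof -
    have "AE y in lborel. (y \<in> {- real (Suc n)<..<real (Suc n)} \<longrightarrow> W y = c n) \<and>
        (y \<in> {- real (Suc 0)<..<real (Suc 0)} \<longrightarrow> W y = c 0)"
      using c[of n] c[of 0] by eventually_elim simp
    \<comment> \<open>The interval \<open>(0, 1)\<close> lies in both symmetric intervals, so a
      common good point identifies the two constants.\<close>
    then obtain y where "0 < y" "y < 1" "(y \<in> {- real (Suc n)<..<real (Suc n)} \<longrightarrow> W y = c n) \<and>
        (y \<in> {- real (Suc 0)<..<real (Suc 0)} \<longrightarrow> W y = c 0)"
      by (rule lborel_AE_obtain[of _ 0 1]) auto
    then show ?thesis by auto
  qed
  have "AE y in lborel. \<forall>n. y \<in> {- real (Suc n)<..<real (Suc n)} \<longrightarrow> W y = c n"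
    using c by (simp add: AE_all_countable)
  then have "AE y in lborel. W y = c 0"
  proof eventually_elim
    case (elim y)
    obtain n where "\<bar>y\<bar> < real n" using reals_Archimedean2 by blast
    then have "y \<in> {- real (Suc n)<..<real (Suc n)}"
      by (auto simp: abs_less_iff)
    then show ?case using elim c0[of n] by auto
  qed
  then show ?thesis by (rule that)
qed

text \<open>If the constant were infinite, \<open>p\<close> would be infinite almost everywhere, and
  a bump could not be square integrable. If it were 0, the measure would be zero, which
  reversibility excludes.\<close>

lemma density_eq_inverse:
  obtains c where "c > 0" "density lborel p = density lborel (\<lambda>x. ennreal (c * inverse (a x)))"
proof -
  obtain c where c: "AE x in lborel. W x = c" by (rule W_constant)
  let ?f = "bump 0 0 1"
  have [measurable]: "?f \<in> borel_measurable borel"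
    by (rule smooth_borel_measurable[OF smooth_bump])
  have "c \<noteq> \<infinity>"
  proof
    assume "c = \<infinity>"
    have "?f \<in> L2_functions (density lborel p)"
      using rev bump_test_function by (auto simp: reversible_measure_def)
    then have "(\<integral>\<^sup>+x. p x * ennreal ((?f x)\<^sup>2) \<partial>lborel) < \<infinity>"
      by (simp add: L2_functions_def integrable_iff_bounded nn_integral_density)
    then have "AE x in lborel. p x * ennreal ((?f x)\<^sup>2) \<noteq> \<infinity>"
      by (intro nn_integral_PInf_AE) auto
    with c have "AE x in lborel. W x = c \<and> p x * ennreal ((?f x)\<^sup>2) \<noteq> \<infinity>"
      by eventually_elim simp
    then obtain x where x: "0 < x" "x < 1" "W x = c \<and> p x * ennreal ((?f x)\<^sup>2) \<noteq> \<infinity>"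
      by (rule lborel_AE_obtain[of _ 0 1]) auto
    then have "p x = \<infinity>"
      using \<open>c = \<infinity>\<close> by (simp add: W_def ennreal_mult_eq_top_iff)
    moreover have "0 < (?f x)\<^sup>2"
      using x bump_pos_iff[of 0 0 1 x] by simp
    ultimately show False
      using x by (simp add: ennreal_mult_eq_top_iff ennreal_eq_0_iff)
  qed
  then obtain r where r: "c = ennreal r" "0 \<le> r"
    by (cases c) auto
  have p_eq: "AE x in lborel. p x = ennreal (r * inverse (a x))"
    using c
  proof eventually_elim
    case (elim x)
    have "p x = p x * ennreal (a x) * ennreal (inverse (a x))"
      using a_pos[of x] by (simp add: mult.assoc less_imp_le flip: ennreal_mult)
    also have "\<dots> = ennreal (r * inverse (a x))"
      using elim r a_pos[of x] by (simp add: W_def ennreal_mult less_imp_le)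
    finally show ?case .
  qed
  then have eq: "density lborel p = density lborel (\<lambda>x. ennreal (r * inverse (a x)))"
    by (intro density_cong) auto
  have "r \<noteq> 0"
  proof
    assume "r = 0"
    then have "emeasure (density lborel p) UNIV = 0"
      unfolding eq by (simp add: emeasure_density)
    then show False using rev by (simp add: reversible_measure_def)
  qed
  with r(2) show ?thesis by (intro that[OF _ eq]) simp
qed

end

lemma reversible_measure_eq_inverse_density:
  assumes "0 < \<alpha>" "\<alpha> < 2" "continuous_on UNIV a" "\<forall>x. a x > 0"
    and \<mu>: "\<mu> \<in> ac_measures" "reversible_measure (levy_operator \<alpha> a b) \<mu>"
  obtains c where "c > 0" "\<mu> = density lborel (\<lambda>x. ennreal (c * inverse (a x)))"
proof -
  obtain p where p: "p \<in> borel_measurable lborel" "density lborel p = \<mu>"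
    using sigma_finite_measure.Radon_Nikodym[OF sigma_finite_lborel, of \<mu>] \<mu>(1)
    by (auto simp: ac_measures_def)
  interpret reversible_density \<alpha> a b p
    using assms p by unfold_locales auto
  show ?thesis
    using density_eq_inverse that p(2) by metis
qed

section \<open>Vanishing of the drift\<close>

lemma drift_eq_0:
  assumes \<alpha>: "0 < \<alpha>" "\<alpha> < 2" and a: "continuous_on UNIV a" "\<forall>x. a x > 0"
    and b: "continuous_on UNIV b" and c: "c > 0"
    and rev: "reversible_measure (levy_operator \<alpha> a b) (density lborel (\<lambda>x. ennreal (c * inverse (a x))))"
  shows "b x = 0"
proof -
  let ?\<mu> = "density lborel (\<lambda>x. ennreal (c * inverse (a x)))"
  define q where "q x = b x / a x" for x
  have a0: "a x \<noteq> 0" for x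
    using a(2) by (metis less_irrefl)
  have [measurable]: "a \<in> borel_measurable borel" "b \<in> borel_measurable borel"
    using a(1) b by (auto intro: borel_measurable_continuous_onI)
  have q_cont: "continuous_on UNIV q"
    unfolding q_def using a(1) b a0 by (intro continuous_on_divide) auto
  have nn: "0 \<le> c * inverse (a x)" for x
    using a(2) c by (simp add: less_imp_le)
  have pair: "L2_inner ?\<mu> (levy_operator \<alpha> a b f) g =
      c * ((LINT x|lborel. frac_laplacian \<alpha> f x * g x) + (LINT x|lborel. q x * deriv f x * g x))"
    if fg: "f \<in> test_functions" "g \<in> test_functions" for f g
  proof -
    have eq: "c * inverse (a x) * (levy_operator \<alpha> a b f x * g x) =
        c * (frac_laplacian \<alpha> f x * g x + q x * deriv f x * g x)" for x
      using a0[of x] by (simp add: levy_operator_def q_def field_simps)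
    have "integrable ?\<mu> (\<lambda>x. levy_operator \<alpha> a b f x * g x)"
      using rev fg by (auto simp: reversible_measure_def)
    then have [measurable]: "(\<lambda>x. levy_operator \<alpha> a b f x * g x) \<in> borel_measurable borel"
      using borel_measurable_integrable by force
    have "integrable lborel (\<lambda>x. q x * deriv f x * g x)"
      by (intro test_functions_mult_integrable fg continuous_on_mult q_cont smooth_continuous_on
          smooth_deriv test_functions_smooth)
    moreover have "L2_inner ?\<mu> (levy_operator \<alpha> a b f) g =
        (LINT x|lborel. c * inverse (a x) * (levy_operator \<alpha> a b f x * g x))"
      unfolding L2_inner_def by (subst integral_real_density) (use nn in auto)
    ultimately show ?thesis
      using frac_laplacian_mult_integrable[OF \<alpha> fg] by (simp add: eq)
  qed
  \<comment> \<open>The jump parts of the two pairings agree by symmetry of the fractional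
    Laplacian. Subtracting them and dividing by the positive \<open>c\<close> leaves the drift
    parts.\<close>
  have defect: "(LINT x|lborel. q x * deriv f x * g x) = (LINT x|lborel. q x * deriv g x * f x)"
    if fg: "f \<in> test_functions" "g \<in> test_functions" for f g
  proof -
    have "L2_inner ?\<mu> (levy_operator \<alpha> a b f) g = L2_inner ?\<mu> (levy_operator \<alpha> a b g) f"
    proof -
      have "L2_inner ?\<mu> (levy_operator \<alpha> a b f) g = L2_inner ?\<mu> f (levy_operator \<alpha> a b g)"
        using rev fg unfolding reversible_measure_def by blast
      then show ?thesis by (simp only: L2_inner_def mult.commute)
    qed
    then show ?thesis
      using c frac_laplacian_symmetric[OF \<alpha> fg] by (simp add: pair fg mult.commute)
  qed
  have square: "(LINT x|lborel. q x * (g x * g x)) = 0" if g: "g \<in> test_functions" for g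
  proof -
    \<comment> \<open>For this choice \<open>deriv f * g - deriv g * f\<close> is exactly
      \<open>g * g\<close>: the terms containing \<open>x * deriv g x * g x\<close> cancel.\<close>
    let ?f = "\<lambda>x. x * g x"
    have f: "?f \<in> test_functions"
      by (rule test_functions_mult[OF g smooth_ident])
    have df: "deriv ?f x = g x + x * deriv g x" for x
      by (rule DERIV_imp_deriv)
         (auto intro!: derivative_eq_intros smooth_DERIV test_functions_smooth g)
    have "integrable lborel (\<lambda>x. q x * deriv ?f x * g x)" "integrable lborel (\<lambda>x. q x * deriv g x * ?f x)"
      by (intro test_functions_mult_integrable f g continuous_on_mult q_cont smooth_continuous_on
          smooth_deriv test_functions_smooth)+
    then have "(LINT x|lborel. q x * deriv ?f x * g x - q x * deriv g x * ?f x) = 0"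
      using defect[OF f g] by simp
    then show ?thesis by (simp add: df algebra_simps)
  qed
  have "q x = 0"
  proof (rule ccontr)
    assume "q x \<noteq> 0"
    \<comment> \<open>Multiplying by \<open>q x\<close> treats both signs at once: by continuity the
      product is positive throughout a neighbourhood of \<open>x\<close>.\<close>
    have "isCont (\<lambda>y. q y * q x) x"
      using q_cont by (intro continuous_intros) (simp add: continuous_on_eq_continuous_at)
    then have "((\<lambda>y. q y * q x) \<longlongrightarrow> q x * q x) (nhds x)"
      by (simp add: isCont_def tendsto_at_iff_tendsto_nhds[of "\<lambda>y. q y * q x"])
    moreover have "0 < q x * q x"
      using \<open>q x \<noteq> 0\<close> by (metis not_real_square_gt_zero)
    ultimately have "\<forall>\<^sub>F y in nhds x. 0 < q y * q x"
      by (rule order_tendstoD(1))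
    then obtain d where d: "d > 0" "\<And>y. \<bar>y - x\<bar> < d \<Longrightarrow> 0 < q y * q x"
      by (auto simp: eventually_nhds_metric dist_real_def)
    let ?g = "bump 0 (x - d) (x + d)"
    have g: "?g \<in> test_functions" by (rule bump_test_function)
    have "integrable lborel (\<lambda>y. q x * q y * ?g y * ?g y)"
      by (intro test_functions_mult_integrable g continuous_on_mult continuous_on_const q_cont
          smooth_continuous_on test_functions_smooth)
    then have int: "integrable lborel (\<lambda>y. q x * (q y * (?g y * ?g y)))"
      by (simp add: mult.assoc)
    have nonneg: "0 \<le> q x * (q y * (?g y * ?g y))" for y
    proof (cases "\<bar>y - x\<bar> < d")
      case True
      then have "0 \<le> (q y * q x) * (?g y * ?g y)"
        by (rule mult_nonneg_nonneg[OF less_imp_le[OF d(2)] zero_le_square])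
      then show ?thesis by (simp add: ac_simps)
    next
      case False
      then have "?g y = 0" by (auto simp: bump_eq_0_iff)
      then show ?thesis by simp
    qed
    have "(LINT y|lborel. q x * (q y * (?g y * ?g y))) = 0"
      using square[OF g] by simp
    \<comment> \<open>A nonnegative function with zero integral vanishes almost everywhere, yet this
      one is positive on all of \<open>(x - d, x + d)\<close>.\<close>
    then have "AE y in lborel. q x * (q y * (?g y * ?g y)) = 0"
      using integral_nonneg_eq_0_iff_AE[OF int] nonneg by simp
    then obtain y where y: "x - d < y" "y < x + d" "q x * (q y * (?g y * ?g y)) = 0"
      by (rule lborel_AE_obtain[of _ "x - d" "x + d"]) (use d in auto)
    then have "0 < ?g y" by (simp add: bump_pos_iff)
    moreover have "0 < q y * q x" using y by (intro d(2)) auto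
    ultimately show False using y(3) by auto
  qed
  then show ?thesis using a0[of x] by (simp add: q_def)
qed

theorem theorem1p1:
  fixes \<alpha> :: real and a b \<sigma> :: "real \<Rightarrow> real"
  assumes "0 < \<alpha>" and "\<alpha> < 2"
    and "continuous_on UNIV a" and "\<forall>x. a x > 0"
    and "\<forall>x. b differentiable (at x)"
    and "\<forall>x. \<sigma> x = a x powr (1 / \<alpha>)"
  shows "(symmetric_operator_in ac_measures (levy_operator \<alpha> a b) \<longleftrightarrow> (\<forall>x. b x = 0)) \<and>
    ((\<forall>x. b x = 0) \<longrightarrow>
       density lborel (\<lambda>x. ennreal (inverse (a x))) \<in> ac_measures \<and>
       reversible_measure (levy_operator \<alpha> a b) (density lborel (\<lambda>x. ennreal (inverse (a x)))) \<and>
       density lborel (\<lambda>x. ennreal (inverse (a x))) =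
         density lborel (\<lambda>x. ennreal (\<sigma> x powr (- \<alpha>))) \<and>
       (\<forall>\<mu> \<in> ac_measures. reversible_measure (levy_operator \<alpha> a b) \<mu> \<longrightarrow>
          (\<exists>c > 0. \<mu> = density lborel (\<lambda>x. ennreal (c * inverse (a x))))))"
proof -
  note rev = reversible_inverse_density[OF assms(1-4)]
  have [measurable]: "a \<in> borel_measurable borel"
    using assms(3) by (rule borel_measurable_continuous_onI)
  have ac: "density lborel (\<lambda>x. ennreal (inverse (a x))) \<in> ac_measures"
    by (simp add: ac_measures_def absolutely_continuousI_density)
  have b_cont: "continuous_on UNIV b"
    using assms(5) by (intro continuous_at_imp_continuous_on)
      (auto intro: differentiable_imp_continuous_within)
  have "b x = 0" if sym: "symmetric_operator_in ac_measures (levy_operator \<alpha> a b)" for x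
  proof -
    obtain \<mu> where \<mu>: "\<mu> \<in> ac_measures" "reversible_measure (levy_operator \<alpha> a b) \<mu>"
      using sym by (auto simp: symmetric_operator_in_def)
    obtain c where c: "c > 0" "\<mu> = density lborel (\<lambda>x. ennreal (c * inverse (a x)))"
      by (rule reversible_measure_eq_inverse_density[OF assms(1-4) \<mu>])
    show ?thesis
      using drift_eq_0[OF assms(1-4) b_cont c(1)] \<mu>(2) c(2) by blast
  qed
  moreover have "\<sigma> x powr (- \<alpha>) = inverse (a x)" for x
  proof -
    have "\<sigma> x powr (- \<alpha>) = a x powr (- 1)"
      using assms(1,6) by (simp add: powr_powr)
    then show ?thesis using assms(4) by (simp add: powr_minus less_imp_le)
  qed
  moreover have "\<exists>c > 0. \<mu> = density lborel (\<lambda>x. ennreal (c * inverse (a x)))"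
    if "\<mu> \<in> ac_measures" "reversible_measure (levy_operator \<alpha> a b) \<mu>" for \<mu>
    by (rule reversible_measure_eq_inverse_density[OF assms(1-4) that]) blast
  moreover have "symmetric_operator_in ac_measures (levy_operator \<alpha> a b)" if "\<forall>x. b x = 0"
    using rev[OF that] ac unfolding symmetric_operator_in_def by blast
  ultimately show ?thesis
    using rev ac by auto
qed

end
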